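(* Let $\mathcal{X}_{\mathrm{Exact}}$ be the set of all $\bm{x}\in\mathcal{X}$ for which there exist $s\in\mathbb{R}$ and $\bm{r}\in\mathbb{R}^N$ such that (i) $s\ge 0$ and $\bm{r}\ge \bm{0}$ (componentwise), (ii) $\epsilon N s-\sum_{i=1}^N r_i\ge \theta N$, (iii) $\left(\frac{\bm{b}_p^\top\bm{\xi}_i+d_p-\bm{a}_p^\top\bm{x}}{\|\bm{b}_p\|_*}\right)^+\ge s-r_i$ for all $i\in[N]$, $p\in[P]$. Then $\mathcal{X}_{\mathrm{Exact}}$ equals the set of all $\bm{x}\in\mathcal{X}$ for which there exist $s\in\mathbb{R}$ and $\bm{r}\in\mathbb{R}^N$ satisfying (i), (ii), (iii) and, in addition, (iv) $\frac{q_p+d_p-\bm{a}_p^\top\bm{x}}{\|\bm{b}_p\|_*}\ge s$ for all $p\in[P]$.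
   Context: Data: positive integers $L,K,N,P$; $[n]:=\{1,\dots,n\}$; $\mathcal{X}\subseteq\mathbb{R}^L$ a compact polyhedron; risk tolerance $\epsilon\in(0,1)$; Wasserstein radius $\theta>0$; samples $\bm{\xi}_1,\dots,\bm{\xi}_N\in\mathbb{R}^K$; for each $p\in[P]$, $\bm{a}_p\in\mathbb{R}^L$, $\bm{b}_p\in\mathbb{R}^K$ with $\bm{b}_p\neq\bm{0}$, and $d_p\in\mathbb{R}$. $\|\cdot\|$ is a norm on $\mathbb{R}^K$ and $\|\cdot\|_*$ its dual norm. $(y)^+:=\max\{0,y\}$ for $y\in\mathbb{R}$. Let $k:=\lfloor\epsilon N\rfloor$, and for each $p\in[P]$ let $q_p$ be the $(k+1)$-th smallest value (counted with multiplicity) among $\bm{b}_p^\top\bm{\xi}_1,\dots,\bm{b}_p^\top\bm{\xi}_N$. *)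

theory Defs
  imports "HOL-Analysis.Analysis"
begin

text \<open>An arbitrary norm, independent of the Euclidean norm that \<open>real ^ 'k\<close> carries
  by type class.\<close>

definition is_norm :: "('v::real_vector \<Rightarrow> real) \<Rightarrow> bool" where
  "is_norm nrm \<longleftrightarrow>
     (\<forall>x. nrm x = 0 \<longleftrightarrow> x = 0) \<and>
     (\<forall>c x. nrm (c *\<^sub>R x) = \<bar>c\<bar> * nrm x) \<and>
     (\<forall>x y. nrm (x + y) \<le> nrm x + nrm y)"

definition dual_norm :: "('v::real_inner \<Rightarrow> real) \<Rightarrow> 'v \<Rightarrow> real" where
  "dual_norm nrm y = (SUP z\<in>{z. nrm z \<le> 1}. y \<bullet> z)"

text \<open>The \<open>m\<close>-th smallest entry (counted with multiplicity), for \<open>1 \<le> m \<le> length vs\<close>.\<close>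

definition kth_smallest :: "nat \<Rightarrow> real list \<Rightarrow> real" where
  "kth_smallest m vs = sort vs ! (m - 1)"

definition quantile ::
  "real \<Rightarrow> nat \<Rightarrow> (nat \<Rightarrow> real ^ 'k) \<Rightarrow> (nat \<Rightarrow> real ^ 'k) \<Rightarrow> nat \<Rightarrow> real" where
  "quantile \<epsilon> N \<xi> b p =
     (let k = nat \<lfloor>\<epsilon> * real N\<rfloor>
      in kth_smallest (k + 1) (map (\<lambda>i. b p \<bullet> \<xi> i) [1..<N + 1]))"

text \<open>Families indexed by \<open>[N]\<close> or \<open>[P]\<close> are functions on \<open>nat\<close> of which only the values at
  \<open>{1..N}\<close> or \<open>{1..P}\<close> are ever used; in particular \<open>r\<close> stands for a vector in \<open>\<real>\<close> to the \<open>N\<close>.\<close>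

definition exact_constraints ::
  "real \<Rightarrow> real \<Rightarrow> nat \<Rightarrow> nat \<Rightarrow> (real ^ 'k \<Rightarrow> real) \<Rightarrow> (nat \<Rightarrow> real ^ 'k) \<Rightarrow>
   (nat \<Rightarrow> real ^ 'l) \<Rightarrow> (nat \<Rightarrow> real ^ 'k) \<Rightarrow> (nat \<Rightarrow> real) \<Rightarrow>
   real ^ 'l \<Rightarrow> real \<Rightarrow> (nat \<Rightarrow> real) \<Rightarrow> bool" where
  "exact_constraints \<epsilon> \<theta> N P nrm \<xi> a b d x s r \<longleftrightarrow>
     s \<ge> 0 \<and> (\<forall>i\<in>{1..N}. r i \<ge> 0) \<and>
     \<epsilon> * real N * s - (\<Sum>i=1..N. r i) \<ge> \<theta> * real N \<and>
     (\<forall>i\<in>{1..N}. \<forall>p\<in>{1..P}.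
        max 0 ((b p \<bullet> \<xi> i + d p - a p \<bullet> x) / dual_norm nrm (b p)) \<ge> s - r i)"

definition X_Exact ::
  "(real ^ 'l) set \<Rightarrow> real \<Rightarrow> real \<Rightarrow> nat \<Rightarrow> nat \<Rightarrow> (real ^ 'k \<Rightarrow> real) \<Rightarrow> (nat \<Rightarrow> real ^ 'k) \<Rightarrow>
   (nat \<Rightarrow> real ^ 'l) \<Rightarrow> (nat \<Rightarrow> real ^ 'k) \<Rightarrow> (nat \<Rightarrow> real) \<Rightarrow> (real ^ 'l) set" where
  "X_Exact X \<epsilon> \<theta> N P nrm \<xi> a b d =
     {x \<in> X. \<exists>s r. exact_constraints \<epsilon> \<theta> N P nrm \<xi> a b d x s r}"

end

theory Submission
  imports Defs
begin

text \<open>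
  Why the extra constraint costs nothing: write \<open>t p\<close> for the scaled quantile margin
  \<open>(quantile \<epsilon> N \<xi> b p + d p - a p \<bullet> x) / dual_norm nrm (b p)\<close> and \<open>k\<close> for the integer part of
  \<open>\<epsilon> N\<close>.  If a feasible \<open>s\<close> exceeds the positive part of some \<open>t p\<close>, then the samples
  whose margin is at most \<open>t p\<close>, of which there are at least \<open>k + 1\<close>, must all have a slack \<open>r i\<close> of at least the excess.
  Lowering \<open>s\<close> by an amount \<open>\<delta>\<close> up to that excess therefore allows at least \<open>k + 1\<close> slacks to
  be lowered by \<open>\<delta>\<close> as well; the budget \<open>\<epsilon> N s - (\<Sum>i=1..N. r i)\<close> loses \<open>\<epsilon> N \<delta>\<close> and gains at
  least \<open>(k + 1) \<delta>\<close>, which is more (\<open>lower_threshold_preserves_budget\<close>).  So \<open>s\<close> may be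
  lowered to the least of its old value and all the positive parts.  The result is still
  positive, because the budget has to reach \<open>\<theta> N > 0\<close>; hence it is bounded by every \<open>t p\<close>
  itself and not merely by its positive part.

  Two facts from outside this exchange argument enter: the order statistic really has \<open>k + 1\<close>
  sample values below it, and dividing by the dual norm preserves order.  The latter rests on
  finite dimension: the dual norm is a supremum in \<open>\<real>\<close>, which is meaningful only since all norms
  on a Euclidean space are equivalent.
\<close>

section \<open>The dual norm\<close>

lemma is_norm_nonneg:
  assumes "is_norm nrm"
  shows "0 \<le> nrm x"
proof -
  have "nrm (x + (-1) *\<^sub>R x) \<le> nrm x + nrm ((-1) *\<^sub>R x)"
    and "nrm ((-1) *\<^sub>R x) = \<bar>-1\<bar> * nrm x" and "nrm 0 = 0"
    using assms unfolding is_norm_def by blast+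
  then show ?thesis by simp
qed

lemma is_norm_continuous_on:
  fixes nrm :: "'v::euclidean_space \<Rightarrow> real"
  assumes "is_norm nrm"
  shows "continuous_on S nrm"
proof -
  have "convex_on UNIV nrm"
  proof (rule convex_onI)
    fix t :: real and x y :: 'v
    assume "0 < t" "t < 1"
    moreover have "nrm ((1 - t) *\<^sub>R x + t *\<^sub>R y) \<le> nrm ((1 - t) *\<^sub>R x) + nrm (t *\<^sub>R y)"
      and "nrm ((1 - t) *\<^sub>R x) = \<bar>1 - t\<bar> * nrm x" and "nrm (t *\<^sub>R y) = \<bar>t\<bar> * nrm y"
      using assms unfolding is_norm_def by blast+
    ultimately show "nrm ((1 - t) *\<^sub>R x + t *\<^sub>R y) \<le> (1 - t) * nrm x + t * nrm y"
      by simp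
  qed simp
  then show ?thesis
    using convex_on_continuous[OF open_UNIV] continuous_on_subset by blast
qed

text \<open>One half of the equivalence of norms: on the Euclidean unit sphere, a compact set, the
  continuous function \<open>nrm\<close> attains its minimum, and definiteness makes that minimum positive.\<close>

lemma is_norm_dominates_norm:
  fixes nrm :: "'v::euclidean_space \<Rightarrow> real"
  assumes "is_norm nrm"
  obtains c where "c > 0" and "\<And>z. c * norm z \<le> nrm z"
proof -
  obtain w :: 'v where w: "w \<in> sphere 0 1" and w_min: "\<And>z. z \<in> sphere 0 1 \<Longrightarrow> nrm w \<le> nrm z"
  proof -
    have "(SOME i. i \<in> (Basis :: 'v set)) \<in> sphere 0 1"
      by (simp add: SOME_Basis)
    then have "sphere (0::'v) 1 \<noteq> {}" by blast
    then show ?thesis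
      using continuous_attains_inf[OF compact_sphere _ is_norm_continuous_on[OF assms]] that
      by blast
  qed
  have "w \<noteq> 0" using w by auto
  then have "nrm w \<noteq> 0" using assms unfolding is_norm_def by blast
  then have "nrm w > 0" using is_norm_nonneg[OF assms, of w] by linarith
  moreover have "nrm w * norm z \<le> nrm z" for z
  proof (cases "z = 0")
    case True
    then show ?thesis using is_norm_nonneg[OF assms, of z] by simp
  next
    case False
    have "nrm w \<le> nrm (inverse (norm z) *\<^sub>R z)"
      using False by (intro w_min) simp
    also have "\<dots> = inverse (norm z) * nrm z"
      using assms unfolding is_norm_def by simp
    finally show ?thesis using False by (simp add: field_simps)
  qed
  ultimately show ?thesis by (rule that)
qed

text \<open>Zero belongs to the unit ball of \<open>nrm\<close>, so the supremum is at least \<open>0\<close> as soon as it is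
  one of a set bounded above; that bound comes from the Cauchy--Schwarz inequality and the
  preceding comparison of norms.\<close>

lemma dual_norm_nonneg:
  fixes nrm :: "'v::euclidean_space \<Rightarrow> real"
  assumes "is_norm nrm"
  shows "0 \<le> dual_norm nrm y"
proof -
  obtain c where c: "c > 0" "\<And>z. c * norm z \<le> nrm z"
    using is_norm_dominates_norm[OF assms] by blast
  have "y \<bullet> z \<le> norm y * (1 / c)" if "nrm z \<le> 1" for z
  proof -
    have "norm z \<le> 1 / c"
      using c(1) c(2)[of z] that by (simp add: field_simps)
    then show ?thesis
      using norm_cauchy_schwarz[of y z] mult_left_mono[of "norm z" "1 / c" "norm y"] by simp
  qed
  then have "bdd_above ((\<lambda>z. y \<bullet> z) ` {z. nrm z \<le> 1})"
    by (intro bdd_aboveI2[where M = "norm y * (1 / c)"]) simp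
  moreover have "0 \<in> {z. nrm z \<le> 1}"
  proof -
    have "nrm 0 = 0" using assms unfolding is_norm_def by blast
    then show ?thesis by simp
  qed
  ultimately have "y \<bullet> 0 \<le> dual_norm nrm y"
    unfolding dual_norm_def by (intro cSUP_upper)
  then show ?thesis by simp
qed

section \<open>Order statistics\<close>

text \<open>The first \<open>m\<close> entries of the sorted list are the witnesses.  Counting list positions
  instead of values is what accounts for ties.\<close>

lemma length_filter_le_kth_smallest:
  assumes "1 \<le> m" and "m \<le> length vs"
  shows "m \<le> length (filter (\<lambda>v. v \<le> kth_smallest m vs) vs)"
proof -
  let ?Q = "\<lambda>v. v \<le> kth_smallest m vs"
  have "?Q v" if "v \<in> set (take m (sort vs))" for v
  proof -
    obtain j where "j < m" "v = sort vs ! j"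
      using \<open>v \<in> set (take m (sort vs))\<close> by (auto simp: in_set_conv_nth)
    then show ?thesis
      using assms unfolding kth_smallest_def by (auto intro: sorted_nth_mono)
  qed
  then have "filter ?Q (take m (sort vs)) = take m (sort vs)"
    by simp
  then have "m = length (filter ?Q (take m (sort vs)))"
    using assms by simp
  also have "\<dots> \<le> length (filter ?Q (take m (sort vs) @ drop m (sort vs)))"
    by (simp only: filter_append length_append)
  also have "\<dots> = length (filter ?Q vs)"
    by (simp add: filter_sort)
  finally show ?thesis .
qed

text \<open>The quantile sits at position \<open>k + 1\<close> with \<open>k\<close> the integer part of \<open>\<epsilon> * N\<close>, and
  \<open>\<epsilon> * N < k + 1\<close>; the bound \<open>\<epsilon> < 1\<close> makes \<open>k + 1 \<le> N\<close>, so that such a position exists.\<close>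

lemma card_le_quantile:
  assumes "0 \<le> \<epsilon>" and "\<epsilon> < 1" and "N > 0"
  shows "\<epsilon> * real N \<le> real (card {i \<in> {1..N}. b p \<bullet> \<xi> i \<le> quantile \<epsilon> N \<xi> b p})"
proof -
  let ?k = "nat \<lfloor>\<epsilon> * real N\<rfloor>"
  let ?Q = "\<lambda>i. b p \<bullet> \<xi> i \<le> quantile \<epsilon> N \<xi> b p"
  have "\<epsilon> * real N < real N" using assms by simp
  then have "?k < N" using assms by (simp add: nat_less_iff floor_less_iff)
  then have "?k + 1 \<le> length (filter (\<lambda>v. v \<le> quantile \<epsilon> N \<xi> b p) (map (\<lambda>i. b p \<bullet> \<xi> i) [1..<N + 1]))"
    unfolding quantile_def Let_def by (intro length_filter_le_kth_smallest) simp_all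
  also have "\<dots> = length (filter ?Q [1..<N + 1])"
    by (simp only: filter_map length_map o_def)
  also have "\<dots> = card (set (filter ?Q [1..<N + 1]))"
    by (intro distinct_card[symmetric] distinct_filter distinct_upt)
  also have "set (filter ?Q [1..<N + 1]) = {i \<in> {1..N}. ?Q i}"
    by auto
  finally have "?k + 1 \<le> card {i \<in> {1..N}. ?Q i}" .
  then show ?thesis by linarith
qed

section \<open>Lowering the threshold\<close>

text \<open>The exchange step.  Every index of \<open>J\<close> can give back the full amount \<open>s - s'\<close> of its slack
  and no index has its slack increased, so the slack total drops by at least \<open>card J\<close> times
  \<open>s - s'\<close>, which pays for the loss \<open>c * (s - s')\<close>.\<close>

lemma lower_threshold_preserves_budget:
  fixes c s s' :: real and r :: "'i \<Rightarrow> real"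
  assumes "finite I" and "J \<subseteq> I" and "c \<le> real (card J)" and "s' \<le> s"
    and nonneg: "\<And>i. i \<in> I \<Longrightarrow> 0 \<le> r i"
    and slack: "\<And>i. i \<in> J \<Longrightarrow> s - s' \<le> r i"
  shows "c * s - (\<Sum>i\<in>I. r i) \<le> c * s' - (\<Sum>i\<in>I. max 0 (r i - (s - s')))"
proof -
  have "c * (s - s') \<le> real (card J) * (s - s')"
    using assms by (intro mult_right_mono) simp_all
  also have "\<dots> = (\<Sum>i\<in>J. s - s')" by simp
  also have "\<dots> = (\<Sum>i\<in>J. r i - max 0 (r i - (s - s')))"
    using slack by (intro sum.cong) force+
  also have "\<dots> \<le> (\<Sum>i\<in>I. r i - max 0 (r i - (s - s')))"
    using assms by (intro sum_mono2) force+
  finally show ?thesis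
    by (simp add: sum_subtractf algebra_simps)
qed

text \<open>Lowering \<open>s\<close> to the least positive part and each slack by the same amount, truncated at
  \<open>0\<close>, keeps every difference \<open>s - r i\<close> from growing, so the margin constraints survive; the
  budget survives by the exchange step, applied to an index \<open>p\<close> at which the minimum is attained.\<close>

lemma exact_constraints_lower_to_quantile:
  assumes eps: "0 < \<epsilon>" "\<epsilon> < 1" and "\<theta> > 0" and "N > 0" and "is_norm nrm"
    and feasible: "exact_constraints \<epsilon> \<theta> N P nrm \<xi> a b d x s r"
  shows "\<exists>s r. exact_constraints \<epsilon> \<theta> N P nrm \<xi> a b d x s r \<and>
    (\<forall>p\<in>{1..P}. (quantile \<epsilon> N \<xi> b p + d p - a p \<bullet> x) / dual_norm nrm (b p) \<ge> s)"
proof -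
  define t where "t p = (quantile \<epsilon> N \<xi> b p + d p - a p \<bullet> x) / dual_norm nrm (b p)" for p
  define f where "f p i = (b p \<bullet> \<xi> i + d p - a p \<bullet> x) / dual_norm nrm (b p)" for p i
  define T where "T = insert s ((\<lambda>p. max 0 (t p)) ` {1..P})"
  define s' where "s' = Min T"
  define r' where "r' i = max 0 (r i - (s - s'))" for i
  have s0: "0 \<le> s" and r0: "\<And>i. i \<in> {1..N} \<Longrightarrow> 0 \<le> r i"
    and budget: "\<theta> * real N \<le> \<epsilon> * real N * s - (\<Sum>i=1..N. r i)"
    and margin: "\<And>i p. i \<in> {1..N} \<Longrightarrow> p \<in> {1..P} \<Longrightarrow> s - r i \<le> max 0 (f p i)"
    using feasible unfolding exact_constraints_def f_def by blast+
  have T: "finite T" "T \<noteq> {}" by (auto simp: T_def)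
  \<comment> \<open>Having \<open>s\<close> itself in \<open>T\<close> ensures that the threshold is never raised.\<close>
  have "s' \<le> s" unfolding s'_def using T by (intro Min_le) (simp_all add: T_def)
  have s'_le: "s' \<le> max 0 (t p)" if "p \<in> {1..P}" for p
    unfolding s'_def using T that by (intro Min_le) (simp_all add: T_def)
  have s'0: "0 \<le> s'" unfolding s'_def using T s0 by (auto simp: T_def)
  have budget_mono: "\<epsilon> * real N * s - (\<Sum>i=1..N. r i) \<le> \<epsilon> * real N * s' - (\<Sum>i=1..N. r' i)"
  proof (cases "s' = s")
    case True
    have "(\<Sum>i=1..N. r' i) = (\<Sum>i=1..N. r i)"
      using r0 by (intro sum.cong) (simp_all add: r'_def True)
    then show ?thesis by (simp add: True)
  next
    case False
    have "s' \<in> T" unfolding s'_def using T by (rule Min_in)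
    then obtain p where p: "p \<in> {1..P}" "s' = max 0 (t p)"
      using False by (auto simp: T_def)
    let ?J = "{i \<in> {1..N}. b p \<bullet> \<xi> i \<le> quantile \<epsilon> N \<xi> b p}"
    have "s - s' \<le> r i" if "i \<in> ?J" for i
    proof -
      have "f p i \<le> t p"
        using that dual_norm_nonneg[OF \<open>is_norm nrm\<close>, of "b p"] unfolding f_def t_def
        by (intro divide_right_mono) simp_all
      then show ?thesis using margin[of i p] p that by auto
    qed
    then show ?thesis
      unfolding r'_def using eps \<open>N > 0\<close> \<open>s' \<le> s\<close> r0
      by (intro lower_threshold_preserves_budget[where J = ?J] card_le_quantile) auto
  qed
  \<comment> \<open>Positivity of the new threshold removes the positive parts: \<open>s' \<le> max 0 (t p)\<close> becomes
    \<open>s' \<le> t p\<close>.\<close>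
  have "s' \<noteq> 0"
  proof
    assume "s' = 0"
    moreover have "0 \<le> (\<Sum>i=1..N. r' i)" by (intro sum_nonneg) (simp add: r'_def)
    moreover have "0 < \<theta> * real N" using \<open>\<theta> > 0\<close> \<open>N > 0\<close> by simp
    ultimately show False using budget budget_mono by simp
  qed
  then have "s' \<le> t p" if "p \<in> {1..P}" for p
    using s'_le[OF that] s'0 by (simp add: max_def split: if_splits)
  moreover have "exact_constraints \<epsilon> \<theta> N P nrm \<xi> a b d x s' r'"
    unfolding exact_constraints_def f_def[symmetric]
  proof (intro conjI ballI)
    show "0 \<le> s'" by (rule s'0)
    show "0 \<le> r' i" for i by (simp add: r'_def)
    show "\<theta> * real N \<le> \<epsilon> * real N * s' - (\<Sum>i=1..N. r' i)"
      using budget budget_mono by linarith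
    show "s' - r' i \<le> max 0 (f p i)" if "i \<in> {1..N}" "p \<in> {1..P}" for i p
      using margin[OF that] unfolding r'_def by linarith
  qed
  ultimately show ?thesis unfolding t_def by blast
qed

theorem theorem1:
  fixes X :: "(real ^ 'l) set"
    and \<epsilon> \<theta> :: real
    and N P :: nat
    and nrm :: "real ^ 'k \<Rightarrow> real"
    and \<xi> :: "nat \<Rightarrow> real ^ 'k"
    and a :: "nat \<Rightarrow> real ^ 'l"
    and b :: "nat \<Rightarrow> real ^ 'k"
    and d :: "nat \<Rightarrow> real"
  assumes "polyhedron X" and "compact X"
    and "0 < \<epsilon>" and "\<epsilon> < 1"
    and "\<theta> > 0"
    and "N > 0" and "P > 0"
    and "is_norm nrm"
    and "\<forall>p\<in>{1..P}. b p \<noteq> 0"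
  shows "X_Exact X \<epsilon> \<theta> N P nrm \<xi> a b d =
    {x \<in> X. \<exists>s r. exact_constraints \<epsilon> \<theta> N P nrm \<xi> a b d x s r \<and>
       (\<forall>p\<in>{1..P}. (quantile \<epsilon> N \<xi> b p + d p - a p \<bullet> x) / dual_norm nrm (b p) \<ge> s)}"
  unfolding X_Exact_def
  using exact_constraints_lower_to_quantile[OF assms(3-6,8)] by blast

end
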